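(* For each choice of sign $\varepsilon\in\{1,-1\}$ and all non-negative integers $\alpha,\beta,\gamma\le 15$, define the coefficients $e_\alpha(n)$, $f_\beta(n)$, $g_\gamma(n)$ (depending on $\varepsilon$) by the power series expansions $$\sum_{n=0}^{\infty}e_\alpha(n)q^n=\left(\varepsilon q,\varepsilon q^6;q^7\right)_\infty\left(q^\alpha,q^{21-\alpha};q^{21}\right)_\infty,$$ $$\sum_{n=0}^{\infty}f_\beta(n)q^n=\left(\varepsilon q^2,\varepsilon q^5;q^7\right)_\infty\left(q^\beta,q^{21-\beta};q^{21}\right)_\infty,$$ $$\sum_{n=0}^{\infty}g_\gamma(n)q^n=\left(\varepsilon q^3,\varepsilon q^4;q^7\right)_\infty\left(q^\gamma,q^{21-\gamma};q^{21}\right)_\infty.$$ Then, for each choice of $\varepsilon\in\{1,-1\}$ and all integers $n\ge 0$, $$e_2(7n+5)=e_5(7n+6)=e_9(7n+2)=0,$$ $$f_3(7n+5)=f_4(7n+3)=f_{10}(7n+4)=0,$$ $$g_1(7n+4)=g_6(7n+1)=g_8(7n+6)=0.$$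
   Context: For complex numbers $a,q$ with $|q|<1$, $(a;q)_\infty:=\prod_{k=0}^{\infty}(1-aq^k)$ and $(a_1,a_2,\dots,a_m;q)_\infty:=(a_1;q)_\infty(a_2;q)_\infty\cdots(a_m;q)_\infty$. The infinite products are expanded as power series in $q$. *)

theory Defs
  imports "HOL-Complex_Analysis.Complex_Analysis"
begin

definition qpoch :: "complex \<Rightarrow> complex \<Rightarrow> complex" where
  "qpoch a q = (\<Prod>k. 1 - a * q ^ k)"

definition qpochs :: "complex list \<Rightarrow> complex \<Rightarrow> complex" where
  "qpochs as q = (\<Prod>a\<leftarrow>as. qpoch a q)"

definition power_series_expansion :: "(nat \<Rightarrow> complex) \<Rightarrow> (complex \<Rightarrow> complex) \<Rightarrow> bool" where
  "power_series_expansion c F \<longleftrightarrow> (\<forall>q. norm q < 1 \<longrightarrow> (\<lambda>n. c n * q ^ n) sums F q)"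

text \<open>
  The remaining facts show that the products considered here do have a power series expansion
  on the open unit disc, and only one, so that hypotheses of the form
  \<^term>\<open>power_series_expansion c F\<close> define the coefficients.
\<close>

lemma power_series_expansion_unique:
  assumes "power_series_expansion c F" "power_series_expansion d F"
  shows "c = d"
proof -
  have *: "F has_fps_expansion Abs_fps c" if "power_series_expansion c F" for c
  proof (rule has_fps_expansionI)
    have "eventually (\<lambda>q. q \<in> ball (0::complex) 1) (nhds 0)"
      by (intro eventually_nhds_in_open) auto
    thus "eventually (\<lambda>q. (\<lambda>n. fps_nth (Abs_fps c) n * q ^ n) sums F q) (nhds 0)"
      by eventually_elim (use that in \<open>auto simp: power_series_expansion_def\<close>)
  qed
  have "Abs_fps c = Abs_fps d"
    using *[OF assms(1)] *[OF assms(2)] by (rule fps_expansion_unique_complex)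
  thus ?thesis by (simp add: fps_eq_iff fun_eq_iff)
qed

lemma qpoch_holomorphic:
  assumes "b > 0"
  shows "(\<lambda>q. qpoch (c * q ^ a) (q ^ b)) holomorphic_on ball 0 1"
proof (rule holomorphic_uniform_sequence)
  fix z :: complex assume z: "z \<in> ball 0 1"
  define r where "r = (1 + norm z) / 2"
  have r: "0 < r" "r < 1" "norm z < r" using z by (auto simp: r_def add_pos_nonneg)
  have bound: "norm (c * q ^ a * (q ^ b) ^ k) \<le> norm c * r ^ k"
    if "norm q \<le> r" for q k
  proof -
    have "norm q ^ a \<le> 1" using that r by (intro power_le_one) auto
    moreover have "(norm q ^ b) ^ k \<le> r ^ k"
    proof (rule power_mono)
      have "norm q ^ b \<le> norm q ^ 1"
        using that r assms by (intro power_decreasing) auto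
      thus "norm q ^ b \<le> r" using that by simp
    qed auto
    ultimately have "norm q ^ a * (norm q ^ b) ^ k \<le> 1 * r ^ k"
      by (intro mult_mono) auto
    thus ?thesis by (simp add: norm_mult norm_power mult.assoc mult_left_mono)
  qed
  have geom: "summable (\<lambda>k. norm c * r ^ k)"
    using r by (intro summable_mult summable_geometric) auto
  from geom have "uniformly_convergent_on (cball 0 r) (\<lambda>N q. \<Sum>k<N. norm (c * q ^ a * (q ^ b) ^ k))"
    by (intro Weierstrass_m_test'[where M = "\<lambda>k. norm c * r ^ k"]) (simp_all add: bound)
  hence *: "uniformly_convergent_on (cball 0 r)
          (\<lambda>N q. \<Prod>k<N. 1 - c * q ^ a * (q ^ b) ^ k)"
    by (intro uniformly_convergent_on_prod') (simp_all, intro continuous_intros)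
  then obtain h where h:
    "uniform_limit (cball 0 r) (\<lambda>N q. \<Prod>k<N. 1 - c * q ^ a * (q ^ b) ^ k) h sequentially"
    unfolding uniformly_convergent_on_def by blast
  have "h q = (\<Prod>k. 1 - c * q ^ a * (q ^ b) ^ k)" if q: "q \<in> cball 0 r" for q
  proof -
    have "summable (\<lambda>k. norm (c * q ^ a * (q ^ b) ^ k))"
      by (rule summable_comparison_test'[OF geom, of 0]) (use q bound in simp)
    hence "convergent_prod (\<lambda>k. 1 - c * q ^ a * (q ^ b) ^ k)"
      by (intro abs_convergent_prod_imp_convergent_prod summable_imp_abs_convergent_prod)
         simp
    hence "(\<lambda>N. \<Prod>k<Suc N. 1 - c * q ^ a * (q ^ b) ^ k) \<longlonglongrightarrow> (\<Prod>k. 1 - c * q ^ a * (q ^ b) ^ k)"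
      unfolding lessThan_Suc_atMost by (rule convergent_prod_LIMSEQ)
    hence "(\<lambda>N. \<Prod>k<N. 1 - c * q ^ a * (q ^ b) ^ k) \<longlonglongrightarrow> (\<Prod>k. 1 - c * q ^ a * (q ^ b) ^ k)"
      by (rule LIMSEQ_imp_Suc)
    thus ?thesis using LIMSEQ_unique[OF tendsto_uniform_limitI[OF h q]] by blast
  qed
  hence "uniform_limit (cball 0 r) (\<lambda>N q. \<Prod>k<N. 1 - c * q ^ a * (q ^ b) ^ k) h sequentially \<longleftrightarrow>
         uniform_limit (cball 0 r) (\<lambda>N q. \<Prod>k<N. 1 - c * q ^ a * (q ^ b) ^ k)
           (\<lambda>q. \<Prod>k. 1 - c * q ^ a * (q ^ b) ^ k) sequentially"
    by (intro uniform_limit_cong' refl)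
  with h have "uniform_limit (cball 0 r) (\<lambda>N q. \<Prod>k<N. 1 - c * q ^ a * (q ^ b) ^ k)
           (\<lambda>q. \<Prod>k. 1 - c * q ^ a * (q ^ b) ^ k) sequentially"
    by (rule iffD1[rotated])
  moreover have "cball z (r - norm z) \<subseteq> cball 0 r"
    by (simp add: cball_subset_cball_iff)
  ultimately have "uniform_limit (cball z (r - norm z))
      (\<lambda>N q. \<Prod>k<N. 1 - c * q ^ a * (q ^ b) ^ k)
      (\<lambda>q. qpoch (c * q ^ a) (q ^ b)) sequentially"
    unfolding qpoch_def by (rule uniform_limit_on_subset)
  moreover have "cball z (r - norm z) \<subseteq> ball 0 1"
    using r by (simp add: cball_subset_ball_iff)
  moreover have "r - norm z > 0"
    using r by simp
  ultimately show "\<exists>d>0. cball z d \<subseteq> ball 0 1 \<and>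
      uniform_limit (cball z d) (\<lambda>N q. \<Prod>k<N. 1 - c * q ^ a * (q ^ b) ^ k)
        (\<lambda>q. qpoch (c * q ^ a) (q ^ b)) sequentially"
    by blast
qed (auto intro!: holomorphic_intros)

lemma power_series_expansion_exists:
  assumes "m > 0" "l > 0"
  shows "\<exists>e. power_series_expansion e
           (\<lambda>q. qpochs [c * q ^ i, c * q ^ j] (q ^ m) * qpochs [q ^ s, q ^ t] (q ^ l))"
    (is "\<exists>e. power_series_expansion e ?F")
proof -
  have "(\<lambda>q. (qpoch (c * q ^ i) (q ^ m) * qpoch (c * q ^ j) (q ^ m)) *
             (qpoch (1 * q ^ s) (q ^ l) * qpoch (1 * q ^ t) (q ^ l))) holomorphic_on ball 0 1"
    by (intro holomorphic_on_mult qpoch_holomorphic assms)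
  hence "?F holomorphic_on ball 0 1" by (simp add: qpochs_def)
  hence "power_series_expansion (\<lambda>n. (deriv ^^ n) ?F 0 / fact n) ?F"
    using holomorphic_power_series[of ?F 0 1] unfolding power_series_expansion_def by simp
  thus ?thesis by blast
qed

end

theory Submission
  imports Defs
begin

text \<open>
  By the Jacobi triple product identity, multiplying any of the nine products by
  \<open>(q ^ 7; q ^ 7)\<^sub>\<infinity> (q ^ 21; q ^ 21)\<^sub>\<infinity>\<close> turns it into a double theta series, a sum over all pairs of
  integers \<open>(m, n)\<close> of \<open>(- \<epsilon>) powi m * (- 1) powi n * q powi N\<close> with a quadratic exponent
  \<open>N = 7 m (m - 1) / 2 + a m + 21 n (n - 1) / 2 + b n\<close>. The extra factor is a series in \<open>q ^ 7\<close> with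
  constant term 1, so a whole residue class of coefficients modulo 7 vanishes before the
  multiplication if and only if it does afterwards.

  Up to an affine change of variables, a factor and a constant, \<open>N\<close> is the form \<open>X\<^sup>2 + 3 * Y\<^sup>2\<close>. This form has rational
  automorphisms of denominator 7, because the prime 7 splits in the field generated by \<open>sqrt (-3)\<close>.
  When \<open>b\<close> is congruent to \<open>2 * a\<close> modulo 7, one of the corresponding reflections maps the set of all
  \<open>(m, n)\<close> for which \<open>N\<close> lies in a suitable residue class modulo 7 to itself
  (\<open>theta_exponent_reflection\<close>, \<open>theta_exponent_residue\<close>). It preserves \<open>N\<close> and the parity of \<open>m\<close>
  but changes the parity of \<open>n\<close>. So the terms cancel in pairs, for both choices of
  \<open>\<epsilon>\<close>, and all coefficients in that residue class are zero (\<open>vanishing_coefficients\<close>).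

  The argument is carried out with convergent series: the residue class is selected by averaging
  over \<open>\<omega> ^ j * q\<close> for a seventh root of unity \<open>\<omega>\<close>. The triple product identity comes from
  the \<open>q\<close>-binomial theorem (\<open>finite_jacobi_triple_product\<close>) by a limit
  (\<open>jacobi_triple_product\<close>).
\<close>

section \<open>The Jacobi triple product identity\<close>

text \<open>
  The quotient \<open>u n / (u j * u (n - j))\<close> is the Gaussian binomial coefficient. Peeling off the
  factor at \<open>k = 0\<close> replaces \<open>x\<close> by \<open>x * q\<close> in the remaining product, and comparing coefficients
  of \<open>x\<close> turns the induction step into the \<open>q\<close>-analogue of Pascal's rule.
\<close>
lemma q_binomial:
  fixes q x :: complex
  assumes "norm q < 1"
  defines "u \<equiv> \<lambda>n. \<Prod>k<n. 1 - q ^ Suc k"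
  shows "(\<Prod>k<n. 1 + x * q ^ k) = (\<Sum>j\<le>n. u n / (u j * u (n - j)) * q ^ (j choose 2) * x ^ j)"
proof (induction n arbitrary: x)
  case 0
  show ?case by (simp add: u_def numeral_2_eq_2)
next
  case (Suc n)
  have q: "q ^ Suc k \<noteq> 1" for k
  proof
    assume "q ^ Suc k = 1"
    hence "norm q ^ Suc k = 1" by (metis norm_one norm_power)
    moreover have "norm q ^ Suc k \<le> norm q" using power_decreasing[of 1 "Suc k" "norm q"] assms(1) by simp
    ultimately show False using assms(1) by simp
  qed
  hence u0: "u k \<noteq> 0" for k by (auto simp: u_def)
  have uS: "u (Suc k) = u k * (1 - q ^ Suc k)" for k by (simp add: u_def)
  define B where "B = (\<lambda>n j. u n / (u j * u (n - j)))"
  \<comment> \<open>Cut off at \<open>n\<close>, since subtraction on naturals makes \<open>B n (Suc n)\<close> nonzero.\<close>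
  define b where "b = (\<lambda>j. if j \<le> n then B n j else 0)"
  have u_0: "u 0 = 1" by (simp add: u_def)
  have B0: "B k 0 = 1" for k using u0[of k] u_0 by (simp add: B_def)
  have Pascal: "B (Suc n) (Suc j) = b j + q ^ Suc j * b (Suc j)" if "j \<le> n" for j
  proof (cases "j = n")
    case True
    thus ?thesis using u0[of n] u0[of "Suc n"] u_0 by (simp add: B_def b_def)
  next
    case False
    hence "Suc j \<le> n" using that by simp
    then obtain d where d: "n = Suc j + d" using le_Suc_ex by blast
    have "1 - q ^ Suc n = (1 - q ^ Suc j) + q ^ Suc j * (1 - q ^ Suc d)"
      by (simp add: d power_add algebra_simps)
    hence "u (Suc n) = u n * ((1 - q ^ Suc j) + q ^ Suc j * (1 - q ^ Suc d))"
      by (simp only: uS)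
    moreover have "b j = u n / (u j * u (Suc d))" "b (Suc j) = u n / (u (Suc j) * u d)"
       "B (Suc n) (Suc j) = u (Suc n) / (u (Suc j) * u (Suc d))"
      by (simp_all add: b_def B_def d)
    moreover have "U * (C + Q * D) / ((x * C) * (y * D)) = U / (x * (y * D)) + Q * (U / ((x * C) * y))"
      if "x \<noteq> 0" "y \<noteq> 0" "C \<noteq> 0" "D \<noteq> 0" for U C D Q x y :: complex
      using that by (simp add: field_simps)
    ultimately show ?thesis
      using u0[of j] u0[of d] q[of j] q[of d] by (simp only: uS) simp
  qed
  have ch: "Suc j choose 2 = (j choose 2) + j" for j
    by (simp add: numeral_2_eq_2)
  have "(\<Prod>k<Suc n. 1 + x * q ^ k) = (1 + x) * (\<Prod>k<n. 1 + (x * q) * q ^ k)"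
    unfolding prod.lessThan_Suc_shift by (simp add: mult.assoc)
  also have "\<dots> = (1 + x) * (\<Sum>j\<le>n. b j * q ^ (j choose 2) * (x * q) ^ j)"
    unfolding Suc.IH by (intro arg_cong2[where f="(*)"] sum.cong) (auto simp: b_def B_def)
  also have "\<dots> = (\<Sum>j\<le>n. b j * q ^ (j choose 2) * (x * q) ^ j) + (\<Sum>j\<le>n. b j * q ^ (Suc j choose 2) * x ^ Suc j)"
    unfolding distrib_right mult_1_left sum_distrib_left sum.distrib
    by (intro arg_cong2[where f="(+)"] sum.cong refl) (simp add: ch power_add power_mult_distrib mult_ac)
  also have "(\<Sum>j\<le>n. b j * q ^ (j choose 2) * (x * q) ^ j) = (\<Sum>j\<le>Suc n. b j * q ^ (j choose 2) * (x * q) ^ j)"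
    by (simp add: b_def)
  also have "\<dots> = 1 + (\<Sum>j\<le>n. b (Suc j) * q ^ (Suc j choose 2) * (x * q) ^ Suc j)"
    unfolding sum.atMost_Suc_shift using B0 by (simp add: b_def numeral_2_eq_2)
  also have "\<dots> + (\<Sum>j\<le>n. b j * q ^ (Suc j choose 2) * x ^ Suc j) =
     1 + (\<Sum>j\<le>n. B (Suc n) (Suc j) * q ^ (Suc j choose 2) * x ^ Suc j)"
    unfolding add.assoc sum.distrib[symmetric]
    by (intro arg_cong2[where f="(+)"] sum.cong refl)
       (simp add: Pascal algebra_simps power_mult_distrib)
  also have "\<dots> = (\<Sum>j\<le>Suc n. B (Suc n) j * q ^ (j choose 2) * x ^ j)"
    unfolding sum.atMost_Suc_shift using B0 by (simp add: numeral_2_eq_2)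
  finally show ?case by (simp add: B_def)
qed

lemma qpoch_factors:
  assumes "norm q < 1"
  shows convergent_prod_qpoch: "convergent_prod (\<lambda>k. 1 - a * q ^ k)"
    and qpoch_LIMSEQ: "(\<lambda>n. \<Prod>k<n. 1 - a * q ^ k) \<longlonglongrightarrow> qpoch a q"
proof -
  have "summable (\<lambda>k. norm (a * q ^ k))"
    using assms by (simp add: norm_mult norm_power summable_mult summable_geometric)
  thus *: "convergent_prod (\<lambda>k. 1 - a * q ^ k)"
    by (intro abs_convergent_prod_imp_convergent_prod summable_imp_abs_convergent_prod) simp
  show "(\<lambda>n. \<Prod>k<n. 1 - a * q ^ k) \<longlonglongrightarrow> qpoch a q"
    using convergent_prod_LIMSEQ[OF *] unfolding qpoch_def lessThan_Suc_atMost[symmetric]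
    by (rule LIMSEQ_imp_Suc)
qed

lemma qpoch_nonzero:
  assumes "norm q < 1" "norm a < 1"
  shows "qpoch a q \<noteq> 0"
  unfolding qpoch_def
proof (rule prodinf_nonzero[OF convergent_prod_qpoch[OF assms(1)]])
  fix k
  have "norm (a * q ^ k) \<le> norm a * 1"
    unfolding norm_mult norm_power using assms by (intro mult_left_mono power_le_one) auto
  with assms show "1 - a * q ^ k \<noteq> 0" by auto
qed

text \<open>The \<open>m\<close>-th term of the Laurent expansion in \<open>z\<close> of \<open>(z; q)\<^sub>\<infinity> (q/z; q)\<^sub>\<infinity> (q; q)\<^sub>\<infinity>\<close>.\<close>
definition theta_term :: "complex \<Rightarrow> complex \<Rightarrow> int \<Rightarrow> complex" where
  "theta_term z q m = (- z) powi m * q powi (m * (m - 1) div 2)"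

lemma even_consecutive: "2 * (m * (m - 1) div 2) = m * (m - 1)" for m :: int
  by simp

text \<open>
  This is the binomial theorem for \<open>2 * N\<close> factors at \<open>x = - z / q ^ N\<close>: the last \<open>N\<close> factors are
  those of \<open>(z; q)\<close>, and the first \<open>N\<close> become those of \<open>(q / z; q)\<close> once \<open>- z / q ^ Suc k\<close> is
  pulled out of each. Centring the summation index at \<open>N\<close> merges all powers of \<open>q\<close> outside the
  coefficient into \<open>q powi (m * (m - 1) div 2)\<close>.
\<close>
lemma finite_jacobi_triple_product:
  fixes q z :: complex
  assumes "norm q < 1" "q \<noteq> 0" "z \<noteq> 0"
  defines "u \<equiv> \<lambda>n. \<Prod>k<n. 1 - q ^ Suc k"
  shows "(\<Prod>k<N. 1 - z * q ^ k) * (\<Prod>k<N. 1 - q / z * q ^ k) =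
         (\<Sum>m=-int N..int N. u (2 * N) / (u (nat (int N + m)) * u (nat (int N - m))) * theta_term z q m)"
proof -
  define P where "P = (\<Prod>k<N. - z / q ^ Suc k)"
  have P: "P = (- z) ^ N / q ^ (Suc N choose 2)"
    unfolding P_def by (induction N) (simp_all add: numeral_2_eq_2 power_add field_simps)
  have split: "(\<Prod>k<N + M. f k) = (\<Prod>k<N. f k) * (\<Prod>k<M. f (N + k))" for M and f :: "nat \<Rightarrow> complex"
    by (induction M) (simp_all add: mult.assoc)
  have "(\<Prod>k<2 * N. 1 + (- z / q ^ N) * q ^ k) =
        (\<Prod>k<N. 1 + (- z / q ^ N) * q ^ k) * (\<Prod>k<N. 1 + (- z / q ^ N) * q ^ (N + k))"
    using split[where M = N and f = "\<lambda>k. 1 + (- z / q ^ N) * q ^ k"] by (simp add: mult_2)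
  also have "(\<Prod>k<N. 1 + (- z / q ^ N) * q ^ (N + k)) = (\<Prod>k<N. 1 - z * q ^ k)"
    using assms(2) by (intro prod.cong) (simp_all add: power_add)
  also have "(\<Prod>k<N. 1 + (- z / q ^ N) * q ^ k) = (\<Prod>k<N. 1 - z / q ^ Suc k)"
  proof (subst prod.nat_diff_reindex[symmetric], rule prod.cong)
    fix k assume "k \<in> {..<N}"
    hence "q ^ N = q ^ (N - Suc k) * q ^ Suc k" by (subst power_add[symmetric]) simp
    thus "1 + (- z / q ^ N) * q ^ (N - Suc k) = 1 - z / q ^ Suc k"
      using assms(2) by simp
  qed simp
  also have "\<dots> = (\<Prod>k<N. (- z / q ^ Suc k) * (1 - q / z * q ^ k))"
    using assms(2,3) by (intro prod.cong) (simp_all add: field_simps)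
  also have "\<dots> = P * (\<Prod>k<N. 1 - q / z * q ^ k)"
    unfolding P_def prod.distrib ..
  finally have *: "P * ((\<Prod>k<N. 1 - z * q ^ k) * (\<Prod>k<N. 1 - q / z * q ^ k)) =
      (\<Prod>k<2 * N. 1 + (- z / q ^ N) * q ^ k)" by (simp add: mult_ac)
  have "P \<noteq> 0" unfolding P using assms(2,3) by simp
  have "(\<Prod>k<N. 1 - z * q ^ k) * (\<Prod>k<N. 1 - q / z * q ^ k) =
      (\<Prod>k<2 * N. 1 + (- z / q ^ N) * q ^ k) / P"
    unfolding *[symmetric] using \<open>P \<noteq> 0\<close> by simp
  also have "\<dots> = (\<Sum>j\<le>2 * N. u (2 * N) / (u j * u (2 * N - j)) *
                     (q ^ (j choose 2) * (- z / q ^ N) ^ j / P))"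
    unfolding q_binomial[OF assms(1)] u_def sum_divide_distrib by (simp add: mult.assoc)
  also have "\<dots> = (\<Sum>m=-int N..int N. u (2 * N) / (u (nat (int N + m)) * u (nat (int N - m))) * theta_term z q m)"
  proof (rule sum.reindex_bij_witness[where i = "\<lambda>m. nat (int N + m)" and j = "\<lambda>j. int j - int N"])
    fix j assume j: "j \<in> {..2 * N}"
    define m where "m = int j - int N"
    have ch: "2 * int (k choose 2) = int k * (int k - 1)" for k
      by (induction k) (simp_all add: numeral_2_eq_2 algebra_simps)
    have "2 * (int (j choose 2) - int N * int j + int (Suc N choose 2)) = m * (m - 1)"
      unfolding distrib_left right_diff_distrib ch by (simp add: m_def algebra_simps)
    hence e: "m * (m - 1) div 2 = int (j choose 2) - int N * int j + int (Suc N choose 2)" by simp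
    have "theta_term z q m = q ^ (j choose 2) * (- z / q ^ N) ^ j / P"
      unfolding theta_term_def e P power_divide using assms(2,3)
      by (simp add: m_def power_int_diff power_int_add power_int_mult field_simps flip: power_mult)
    moreover have "nat (int N - m) = 2 * N - j" "nat (int N + m) = j" using j by (auto simp: m_def)
    ultimately show "u (2 * N) / (u (nat (int N + (int j - int N))) * u (nat (int N - (int j - int N)))) * theta_term z q (int j - int N)
      = u (2 * N) / (u j * u (2 * N - j)) * (q ^ (j choose 2) * (- z / q ^ N) ^ j / P)"
      unfolding m_def[symmetric] by simp
  qed auto
  finally show ?thesis .
qed

lemma theta_summable_nat:
  assumes "norm q < 1" "q \<noteq> 0" "z \<noteq> 0"
  shows "summable (\<lambda>n. norm (theta_term z q (int n)))"
proof -
  have "(\<lambda>n. norm z * norm q ^ n) \<longlonglongrightarrow> norm z * 0"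
    using assms by (intro tendsto_intros LIMSEQ_realpow_zero) auto
  hence "\<forall>\<^sub>F n in sequentially. norm z * norm q ^ n < 1 / 2"
    by (rule order_tendstoD) simp
  then obtain M where M: "norm z * norm q ^ n < 1 / 2" if "n \<ge> M" for n
    by (auto simp: eventually_sequentially)
  show ?thesis
  proof (rule summable_ratio_test)
    fix n assume "n \<ge> M"
    have "int (Suc n) * (int (Suc n) - 1) div 2 = int n * (int n - 1) div 2 + int n"
      using even_consecutive[of "int n"] even_consecutive[of "int (Suc n)"] by (simp add: algebra_simps)
    hence "theta_term z q (int (Suc n)) = - z * q ^ n * theta_term z q (int n)"
      unfolding theta_term_def using assms(2,3) by (simp add: power_int_add)
    hence "norm (theta_term z q (int (Suc n))) = (norm z * norm q ^ n) * norm (theta_term z q (int n))"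
      by (simp add: norm_mult norm_power)
    also have "\<dots> \<le> 1 / 2 * norm (theta_term z q (int n))"
      using M[OF \<open>n \<ge> M\<close>] by (intro mult_right_mono) auto
    finally show "norm (norm (theta_term z q (int (Suc n)))) \<le> 1 / 2 * norm (norm (theta_term z q (int n)))"
      by simp
  qed simp
qed

text \<open>The symmetry \<open>z \<mapsto> q / z\<close> of the product reduces negative indices to positive ones.\<close>
lemma theta_term_neg:
  assumes "q \<noteq> 0" "z \<noteq> 0"
  shows "theta_term z q (- m) = theta_term (q / z) q m"
proof -
  have "- m * (- m - 1) div 2 = m * (m - 1) div 2 + m"
    using even_consecutive[of m] even_consecutive[of "-m"] by (simp add: algebra_simps)
  thus ?thesis using assms unfolding theta_term_def
    by (simp add: power_int_add power_int_minus power_int_divide_distrib field_simps flip: power_int_mult_distrib)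
qed

lemma theta_summable:
  assumes "norm q < 1" "q \<noteq> 0" "z \<noteq> 0"
  shows "(\<lambda>m. norm (theta_term z q m)) summable_on UNIV"
proof -
  have half: "(\<lambda>m. norm (theta_term w q m)) summable_on {0..}" if "w \<noteq> 0" for w
  proof -
    have "(\<lambda>n. norm (theta_term w q (int n))) summable_on UNIV"
      using theta_summable_nat[OF assms(1,2) that] by (simp add: summable_on_UNIV_nonneg_real_iff)
    thus ?thesis
      by (subst summable_on_reindex_bij_witness[where j = nat and i = int]) auto
  qed
  have "(\<lambda>m. norm (theta_term z q m)) summable_on {..0}"
    using half[of "q / z"] assms theta_term_neg[OF assms(2,3), of "- m" for m]
    by (subst summable_on_reindex_bij_witness[where j = uminus and i = uminus
          and T = "{0..}" and h = "\<lambda>m. norm (theta_term (q / z) q m)"]) auto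
  hence "(\<lambda>m. norm (theta_term z q m)) summable_on ({..0} \<union> {0..})"
    using half[OF assms(3)] by (rule summable_on_union)
  also have "{..0} \<union> {0::int..} = UNIV" by auto
  finally show ?thesis .
qed

text \<open>
  Let \<open>N\<close> tend to infinity in the finite identity. Since \<open>(q; q)\<^sub>n\<close> converges to the nonzero number
  \<open>(q; q)\<^sub>\<infinity>\<close> and never vanishes, the Gaussian binomial coefficients are uniformly bounded and tend to
  \<open>1 / (q; q)\<^sub>\<infinity>\<close>, so Tannery's theorem allows taking the limit term by term.
\<close>
theorem jacobi_triple_product:
  assumes "norm q < 1" "q \<noteq> 0" "z \<noteq> 0"
  shows "(theta_term z q has_sum (qpoch z q * qpoch (q / z) q * qpoch q q)) UNIV"
proof -
  define u where "u = (\<lambda>n. \<Prod>k<n. 1 - q ^ Suc k)"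
  define U where "U = qpoch q q"
  have lim: "u \<longlonglongrightarrow> U"
    using qpoch_LIMSEQ[OF assms(1), of q] by (simp add: u_def U_def)
  have "U \<noteq> 0" unfolding U_def using assms(1) by (intro qpoch_nonzero)
  have inv_lim: "(\<lambda>n. inverse (u n)) \<longlonglongrightarrow> inverse U"
    using lim \<open>U \<noteq> 0\<close> by (rule tendsto_inverse)
  obtain K where K: "norm (u n) \<le> K" for n
    using convergent_imp_Bseq[OF convergentI[OF lim]] by (auto simp: Bseq_def)
  obtain L where L: "L > 0" "norm (inverse (u n)) \<le> L" for n
    using convergent_imp_Bseq[OF convergentI[OF inv_lim]] by (auto simp: Bseq_def)
  define c where "c = (\<lambda>N m. if \<bar>m\<bar> \<le> int N
                         then u (2 * N) / (u (nat (int N + m)) * u (nat (int N - m))) else 0)"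
  have c_bound: "norm (c N m) \<le> K * (L * L)" for N m
  proof (cases "\<bar>m\<bar> \<le> int N")
    case True
    have "norm (u (2 * N)) * (norm (inverse (u (nat (int N + m)))) * norm (inverse (u (nat (int N - m)))))
            \<le> K * (L * L)"
      by (intro mult_mono K L) (use L(1) order.trans[OF norm_ge_zero K] in auto)
    thus ?thesis using True by (simp add: c_def norm_mult norm_divide norm_inverse field_simps)
  next
    case False
    thus ?thesis using L(1) order.trans[OF norm_ge_zero K] by (simp add: c_def)
  qed
  have c_lim: "(\<lambda>N. c N m) \<longlonglongrightarrow> inverse U" for m
  proof -
    have "filterlim (\<lambda>N. nat (int N + i)) sequentially sequentially" for i
      by (rule filterlim_at_top_mono[OF filterlim_minus_const_nat_at_top[of "nat \<bar>i\<bar>"]])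
         (auto intro!: always_eventually)
    from this[of m] this[of "- m"]
    have "(\<lambda>N. u (nat (int N + m))) \<longlonglongrightarrow> U" "(\<lambda>N. u (nat (int N - m))) \<longlonglongrightarrow> U"
      by (auto intro: filterlim_compose[OF lim])
    moreover have "(\<lambda>N. u (2 * N)) \<longlonglongrightarrow> U"
      by (rule filterlim_compose[OF lim]) (rule mult_nat_left_at_top, simp)
    ultimately have "(\<lambda>N. u (2 * N) / (u (nat (int N + m)) * u (nat (int N - m)))) \<longlonglongrightarrow> U / (U * U)"
      using \<open>U \<noteq> 0\<close> by (intro tendsto_intros) auto
    also have "U / (U * U) = inverse U" using \<open>U \<noteq> 0\<close> by (simp add: field_simps)
    finally have "(\<lambda>N. u (2 * N) / (u (nat (int N + m)) * u (nat (int N - m)))) \<longlonglongrightarrow> inverse U" .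
    moreover have "\<forall>\<^sub>F N in sequentially. u (2 * N) / (u (nat (int N + m)) * u (nat (int N - m))) = c N m"
      using eventually_ge_at_top[of "nat \<bar>m\<bar>"] by eventually_elim (auto simp: c_def)
    ultimately show ?thesis by (rule Lim_transform_eventually)
  qed
  \<comment> \<open>Tannery's theorem concerns series over the naturals, so the integers are enumerated.\<close>
  define a where "a = (\<lambda>k N. c N (int_decode k) * theta_term z q (int_decode k))"
  define b where "b = (\<lambda>k. inverse U * theta_term z q (int_decode k))"
  have bij: "bij_betw int_decode UNIV UNIV" using bij_int_decode by simp
  have summ: "summable (\<lambda>k. norm (theta_term z q (int_decode k)))"
    by (rule summable_on_imp_summable,
        rule summable_on_reindex_bij_betw[OF bij, of "\<lambda>m. norm (theta_term z q m)", THEN iffD2])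
       (rule theta_summable[OF assms])
  have tannery: "(\<lambda>N. \<Sum>k. a k N) \<longlonglongrightarrow> suminf b" and summ_b: "summable (\<lambda>k. norm (b k))"
  proof -
    have "norm (a k N) \<le> K * (L * L) * norm (theta_term z q (int_decode k))" for k N
      unfolding a_def norm_mult by (intro mult_right_mono c_bound) auto
    moreover have "(\<lambda>N. a k N) \<longlonglongrightarrow> b k" for k
      unfolding a_def b_def by (intro tendsto_intros c_lim)
    ultimately have "eventually (\<lambda>N. summable (\<lambda>k. norm (a k N))) sequentially \<and>
           summable (\<lambda>k. norm (b k)) \<and> (\<lambda>N. \<Sum>k. a k N) \<longlonglongrightarrow> suminf b"
      using summ
      by (intro tannerys_theorem[where M = "\<lambda>k. K * (L * L) * norm (theta_term z q (int_decode k))"]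
             always_eventually summable_mult) simp_all
    thus "(\<lambda>N. \<Sum>k. a k N) \<longlonglongrightarrow> suminf b" "summable (\<lambda>k. norm (b k))" by auto
  qed
  have "(\<Sum>k. a k N) = (\<Prod>k<N. 1 - z * q ^ k) * (\<Prod>k<N. 1 - q / z * q ^ k)" for N
  proof -
    have "((\<lambda>m. c N m * theta_term z q m) has_sum
            (\<Sum>m=-int N..int N. c N m * theta_term z q m)) UNIV"
      by (rule has_sum_finite_neutralI[where B = "{-int N..int N}"]) (auto simp: c_def)
    hence "((\<lambda>k. a k N) has_sum (\<Sum>m=-int N..int N. c N m * theta_term z q m)) UNIV"
      unfolding a_def by (rule has_sum_reindex_bij_betw[OF bij, THEN iffD2])
    hence "(\<Sum>k. a k N) = (\<Sum>m=-int N..int N. c N m * theta_term z q m)"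
      by (rule sums_unique[OF has_sum_imp_sums, symmetric])
    also have "\<dots> = (\<Prod>k<N. 1 - z * q ^ k) * (\<Prod>k<N. 1 - q / z * q ^ k)"
      unfolding finite_jacobi_triple_product[OF assms] u_def c_def by (intro sum.cong) auto
    finally show ?thesis .
  qed
  with tannery have "(\<lambda>N. (\<Prod>k<N. 1 - z * q ^ k) * (\<Prod>k<N. 1 - q / z * q ^ k)) \<longlonglongrightarrow> suminf b"
    by simp
  moreover have "(\<lambda>N. (\<Prod>k<N. 1 - z * q ^ k) * (\<Prod>k<N. 1 - q / z * q ^ k)) \<longlonglongrightarrow> qpoch z q * qpoch (q / z) q"
    by (intro tendsto_mult qpoch_LIMSEQ assms(1))
  ultimately have "suminf b = qpoch z q * qpoch (q / z) q" by (rule LIMSEQ_unique)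
  moreover have "(b has_sum suminf b) UNIV"
    by (rule norm_summable_imp_has_sum[OF summ_b summable_sums[OF summable_norm_cancel[OF summ_b]]])
  ultimately have "((\<lambda>m. inverse U * theta_term z q m) has_sum (qpoch z q * qpoch (q / z) q)) UNIV"
    unfolding b_def using has_sum_reindex_bij_betw[OF bij, of "\<lambda>m. inverse U * theta_term z q m", THEN iffD1] by metis
  from has_sum_cmult_right[OF this, of U] show ?thesis
    using \<open>U \<noteq> 0\<close> by (simp add: mult.assoc[symmetric]) (simp add: U_def mult_ac)
qed

section \<open>Unordered infinite sums\<close>

lemma has_sum_mult_product:
  fixes f :: "'a \<Rightarrow> complex" and g :: "'b \<Rightarrow> complex"
  assumes "(f has_sum s) UNIV" "(g has_sum t) UNIV"
  shows "((\<lambda>(x, y). f x * g y) has_sum (s * t)) UNIV"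
proof -
  have norms: "(\<lambda>x. norm (f x)) summable_on UNIV" "(\<lambda>y. norm (g y)) summable_on UNIV"
    using assms[THEN has_sum_imp_summable] by (simp_all add: summable_on_iff_abs_summable_on_complex)
  have "(\<lambda>p. norm (f (fst p) * g (snd p))) summable_on (SIGMA x:UNIV. UNIV)"
  proof (rule summable_on_SigmaI)
    show "((\<lambda>y. norm (f (fst (x, y)) * g (snd (x, y)))) has_sum norm (f x) * infsum (\<lambda>y. norm (g y)) UNIV) UNIV" for x
      using has_sum_cmult_right[OF has_sum_infsum[OF norms(2)], of "norm (f x)"] by (simp add: norm_mult)
    show "(\<lambda>x. norm (f x) * infsum (\<lambda>y. norm (g y)) UNIV) summable_on UNIV"
      using norms(1) by (rule summable_on_cmult_left)
  qed simp
  hence "(\<lambda>p. f (fst p) * g (snd p)) summable_on (SIGMA x:UNIV. UNIV)"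
    by (rule abs_summable_summable)
  hence "((\<lambda>p. f (fst p) * g (snd p)) has_sum (s * t)) (SIGMA x:UNIV. UNIV)"
    using assms by (intro has_sum_SigmaI[where g = "\<lambda>x. f x * t"]) (auto intro: has_sum_cmult_right has_sum_cmult_left)
  thus ?thesis by (simp add: case_prod_unfold)
qed

lemma has_sum_finite_sum:
  fixes f :: "'i \<Rightarrow> 'a \<Rightarrow> complex"
  assumes "\<And>i. i \<in> I \<Longrightarrow> (f i has_sum s i) A"
  shows "((\<lambda>x. \<Sum>i\<in>I. f i x) has_sum (\<Sum>i\<in>I. s i)) A"
  using assms by (induction I rule: infinite_finite_induct) (auto intro!: has_sum_add)

lemma has_sum_sign_reversing_involution:
  fixes h :: "'a \<Rightarrow> complex"
  assumes "(h has_sum s) UNIV"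
    and "\<And>x. x \<notin> C \<Longrightarrow> h x = 0"
    and "\<And>x. x \<in> C \<Longrightarrow> \<sigma> x \<in> C" "\<And>x. x \<in> C \<Longrightarrow> \<sigma> (\<sigma> x) = x" "\<And>x. x \<in> C \<Longrightarrow> h (\<sigma> x) = - h x"
  shows "s = 0"
proof -
  have "(h has_sum s) C"
    using assms(1,2) by (subst has_sum_cong_neutral[where T = UNIV and g = h]) auto
  moreover have "(h has_sum s) C \<longleftrightarrow> ((\<lambda>x. - h x) has_sum s) C"
    using assms(3-5) by (intro has_sum_reindex_bij_witness[where i = \<sigma> and j = \<sigma>]) auto
  moreover have "((\<lambda>x. - h x) has_sum (- s)) C"
    using \<open>(h has_sum s) C\<close> by (simp add: has_sum_uminus)
  ultimately have "s = - s" by (metis has_sum_unique)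
  thus ?thesis by simp
qed

section \<open>The quadratic exponent and its reflection\<close>

text \<open>
  The power of \<open>q\<close> in the product of the \<open>m\<close>-th and \<open>n\<close>-th terms of the theta series for
  \<open>(q ^ a, q ^ (7 - a), q ^ 7; q ^ 7)\<^sub>\<infinity>\<close> and \<open>(q ^ b, q ^ (21 - b), q ^ 21; q ^ 21)\<^sub>\<infinity>\<close>.
\<close>
definition theta_exponent :: "int \<Rightarrow> int \<Rightarrow> int \<Rightarrow> int \<Rightarrow> int" where
  "theta_exponent a b m n = 7 * (m * (m - 1) div 2) + a * m + 21 * (n * (n - 1) div 2) + b * n"

text \<open>
  With \<open>X = 42 * n + 2 * b - 21\<close> and \<open>Y = 14 * m + 2 * a - 7\<close>, the exponent is an affine function of
  the norm \<open>X\<^sup>2 + 3 * Y\<^sup>2\<close> of \<open>X + Y * sqrt (-3)\<close>. The map \<open>(m, n) \<mapsto> (m', n')\<close> is complex conjugation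
  followed by multiplication with \<open>(1 + 4 * sqrt (-3)) / 7\<close>, which has norm one because
  \<open>1 + 3 * 4\<^sup>2 = 7\<^sup>2\<close>; hence it preserves the exponent. The condition \<open>b = 2 * a + 7 * t\<close> makes the
  constant terms of the map, multiplied by 7, integral. Modulo 2 the two equations read \<open>m' = m\<close> and \<open>n' = n + 1\<close>.
\<close>
lemma theta_exponent_reflection:
  fixes a t m n m' n' :: int
  assumes "7 * m' = 12 * n - m - 2 * (1 - 2 * t)" "7 * n' = 4 * m + n + (1 - 2 * t)"
  shows "theta_exponent a (2 * a + 7 * t) m' n' = theta_exponent a (2 * a + 7 * t) m n"
    and "even m' \<longleftrightarrow> even m" and "even n' \<longleftrightarrow> odd n"
proof -
  have two: "2 * theta_exponent a b m n = 7 * (m * (m - 1)) + 2 * a * m + 21 * (n * (n - 1)) + 2 * b * n"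
    for a b m n
    unfolding theta_exponent_def distrib_left mult.left_commute[of 2] even_consecutive
    by (simp add: mult.assoc mult.left_commute[of _ 2] even_consecutive)
  have "49 * (2 * theta_exponent a (2 * a + 7 * t) m' n') =
          7 * ((7 * m') * (7 * m' - 7)) + 14 * a * (7 * m') + 21 * ((7 * n') * (7 * n' - 7)) + 14 * (2 * a + 7 * t) * (7 * n')"
    unfolding two by (simp add: algebra_simps)
  also have "\<dots> = 49 * (2 * theta_exponent a (2 * a + 7 * t) m n)"
    unfolding assms two by (simp add: algebra_simps)
  finally show "theta_exponent a (2 * a + 7 * t) m' n' = theta_exponent a (2 * a + 7 * t) m n" by simp
  have "m = m' + 2 * (6 * n - 4 * m' - 1 + 2 * t)" "n = n' + 2 * (3 * n' - 2 * m + t) - 1"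
    using assms by simp_all
  thus "even m' \<longleftrightarrow> even m" "even n' \<longleftrightarrow> odd n"
    by (metis dvd_triv_left even_add, metis dvd_triv_left even_add odd_one even_diff)
qed

text \<open>
  Modulo 7 the exponent is \<open>a * (m + 2 * n)\<close>, so fixing its residue amounts to a linear congruence
  between \<open>m\<close> and \<open>n\<close>. For the residue \<open>2 * a * (2 * t - 1)\<close> it is exactly the integrality
  condition of the reflection.
\<close>
lemma theta_exponent_residue:
  fixes a t m n :: int
  assumes "a \<in> {1, 2, 3}" "7 dvd r - 2 * a * (2 * t - 1)"
  shows "7 dvd theta_exponent a (2 * a + 7 * t) m n - r \<longleftrightarrow> 7 dvd 4 * m + n + (1 - 2 * t)"
proof -
  define x where "x = m + 2 * n - 2 * (2 * t - 1)"
  obtain s where s: "r = 2 * a * (2 * t - 1) + 7 * s"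
    using assms(2) by (metis add.commute diff_add_cancel dvdE)
  have "theta_exponent a (2 * a + 7 * t) m n - r =
      7 * (m * (m - 1) div 2 + 3 * (n * (n - 1) div 2) + t * n - s) + (a * m + 2 * a * n - 2 * a * (2 * t - 1))"
    unfolding theta_exponent_def s by (simp add: algebra_simps)
  hence "7 dvd theta_exponent a (2 * a + 7 * t) m n - r \<longleftrightarrow> 7 dvd (a * m + 2 * a * n - 2 * a * (2 * t - 1))"
    by (simp only:) (rule dvd_add_right_iff, simp)
  also have "\<dots> \<longleftrightarrow> 7 dvd a * x"
    by (simp add: x_def algebra_simps)
  also have "\<dots> \<longleftrightarrow> 7 dvd 4 * x"
    using assms(1) by (elim insertE emptyE; simp only:; presburger)
  also have "\<dots> \<longleftrightarrow> 7 dvd 7 * (2 * t - n - 1) + 4 * x"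
    by (rule dvd_add_right_iff[symmetric]) simp
  also have "7 * (2 * t - n - 1) + 4 * x = 4 * m + n + (1 - 2 * t)"
    by (simp add: x_def)
  finally show ?thesis .
qed

section \<open>Vanishing coefficients\<close>

text \<open>Two instances of the triple product identity, with \<open>\<epsilon> = 1 / \<epsilon>\<close> used for \<open>q ^ 7 / (\<epsilon> * q ^ a)\<close>.\<close>
lemma theta_product_has_sum:
  fixes \<epsilon> q :: complex and a b :: nat
  assumes "\<epsilon> \<in> {1, -1}" "norm q < 1" "q \<noteq> 0" "a \<le> 7" "b \<le> 21"
  shows "((\<lambda>(m, n). (- \<epsilon>) powi m * (- 1) powi n * q powi theta_exponent (int a) (int b) m n) has_sum
     (qpochs [\<epsilon> * q ^ a, \<epsilon> * q ^ (7 - a)] (q ^ 7) * qpochs [q ^ b, q ^ (21 - b)] (q ^ 21) *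
       (qpoch (q ^ 7) (q ^ 7) * qpoch (q ^ 21) (q ^ 21)))) UNIV"
proof -
  have theta: "(theta_term (\<delta> * q ^ i) (q ^ l) has_sum
      (qpochs [\<delta> * q ^ i, \<delta> * q ^ (l - i)] (q ^ l) * qpoch (q ^ l) (q ^ l))) UNIV"
    if "\<delta> \<in> {1, -1}" "i \<le> l" "l > 0" for \<delta> i l
  proof -
    have "norm (q ^ l) < 1" using assms(2) that(3) by (simp add: norm_power power_less_one_iff)
    moreover have "q ^ l / (\<delta> * q ^ i) = \<delta> * q ^ (l - i)"
      using that assms(3) by (auto simp: power_diff)
    ultimately show ?thesis
      using jacobi_triple_product[of "q ^ l" "\<delta> * q ^ i"] that assms(3) by (auto simp: qpochs_def)
  qed
  have "theta_term (\<epsilon> * q ^ a) (q ^ 7) m * theta_term (1 * q ^ b) (q ^ 21) n =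
        (- \<epsilon>) powi m * (- 1) powi n * q powi theta_exponent (int a) (int b) m n" for m n
  proof -
    have eq: "theta_term (\<delta> * q ^ i) (q ^ l) m = (- \<delta>) powi m * q powi (int l * (m * (m - 1) div 2) + int i * m)" for \<delta> i l m
      unfolding theta_term_def mult_minus_left[symmetric] power_int_mult_distrib
      using assms(3) by (simp add: power_int_add power_int_mult)
    show ?thesis unfolding eq using assms(3) by (simp add: theta_exponent_def power_int_add mult_ac)
  qed
  thus ?thesis
    using has_sum_mult_product[OF theta[OF assms(1,4)] theta[of 1 b 21]] assms(5)
    by (simp add: mult_ac)
qed

lemma sum_seventh_roots_of_unity:
  fixes \<omega> :: complex and k :: int
  assumes "\<omega> ^ 7 = 1" "\<omega> \<noteq> 1"
  shows "(\<Sum>j<7::nat. (\<omega> ^ j) powi k) = (if 7 dvd k then 7 else 0)"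
proof -
  define w where "w = \<omega> powi k"
  have "\<omega> \<noteq> 0" using assms(1) by auto
  have w: "(\<omega> ^ j) powi k = w ^ j" for j
  proof -
    have "(\<omega> powi int j) powi k = (\<omega> powi k) powi int j"
      unfolding power_int_mult[symmetric] by (simp only: mult.commute)
    thus ?thesis by (simp add: w_def)
  qed
  have w7: "w ^ 7 = 1" using w[of 7] assms(1) by simp
  show ?thesis
  proof (cases "7 dvd k")
    case True
    then obtain d where "k = 7 * d" by blast
    hence "w = (\<omega> ^ 7) powi d" by (simp add: w_def power_int_mult)
    thus ?thesis using True assms(1) by (simp add: w)
  next
    case False
    hence "coprime k 7" using prime_imp_coprime[of 7 k] by (simp add: coprime_commute)
    then obtain x y where "k * x + 7 * y = 1" using bezout_int[of k 7] by (metis coprime_imp_gcd_eq_1 mult.commute)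
    hence "\<omega> = \<omega> powi (k * x + 7 * y)" by simp
    also have "\<dots> = w powi x * (\<omega> ^ 7) powi y"
      using \<open>\<omega> \<noteq> 0\<close> by (simp add: w_def power_int_add power_int_mult)
    finally have "\<omega> = w powi x * (\<omega> ^ 7) powi y" .
    hence "w \<noteq> 1" using assms by (metis mult_1 power_int_1_left)
    thus ?thesis using False w7 by (simp add: w sum_gp_strict)
  qed
qed

text \<open>
  The triple product identity needs \<open>q \<noteq> 0\<close>; continuity of a power series at the origin
  recovers the constant term.
\<close>
lemma power_series_vanishing:
  assumes "\<And>q. norm q < 1 \<Longrightarrow> q \<noteq> 0 \<Longrightarrow> (\<lambda>n. c n * q ^ n) sums (0 :: complex)"
  shows "c n = 0"
proof -
  have "((\<lambda>q::complex. 0) \<longlongrightarrow> c 0) (at 0)"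
    by (rule powser_limit_0_strong[of 1]) (use assms in auto)
  hence "c 0 = 0" by (metis tendsto_const tendsto_unique at_neq_bot)
  hence "(\<lambda>n. c n * q ^ n) sums 0" if "norm q < 1" for q
    using assms[OF that] powser_sums_zero[of c] by (cases "q = 0") auto
  hence "c = (\<lambda>n. 0)"
    by (intro power_series_expansion_unique[where F = "\<lambda>q. 0"]) (auto simp: power_series_expansion_def)
  thus ?thesis by simp
qed

text \<open>
  Averaging over the seventh roots of unity isolates the exponents congruent to \<open>n\<close> modulo 7, both
  in the power series and in the double theta series. The factor \<open>A\<close> by which the two differ depends
  only on \<open>q ^ 7\<close>, so it is constant in the average and can be cancelled. The selected part
  of the theta series is zero because the reflection pairs its terms with opposite signs: the sign
  \<open>(- \<epsilon>) powi m * (- 1) powi l\<close> only sees the parities of \<open>m\<close> and \<open>l\<close>, and only that of \<open>l\<close>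
  changes.
\<close>
theorem vanishing_coefficients:
  fixes \<epsilon> :: complex and a t n :: nat
  assumes "\<epsilon> \<in> {1, -1}" "a \<in> {1, 2, 3}" "t \<le> 2"
    and e: "power_series_expansion e
       (\<lambda>q. qpochs [\<epsilon> * q ^ a, \<epsilon> * q ^ (7 - a)] (q ^ 7) * qpochs [q ^ (2 * a + 7 * t), q ^ (21 - (2 * a + 7 * t))] (q ^ 21))"
    and n: "int n mod 7 = (2 * int a * (2 * int t - 1)) mod 7"
  shows "e n = 0"
proof -
  define b where "b = 2 * a + 7 * t"
  define \<omega> :: complex where "\<omega> = cis (2 * pi / 7)"
  have "\<omega> ^ 7 = cis (2 * pi)" unfolding \<omega>_def Complex.DeMoivre by (rule arg_cong[of _ _ cis]) simp
  hence \<omega>7: "\<omega> ^ 7 = 1" by simp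
  have \<omega>1: "\<omega> \<noteq> 1"
  proof
    assume "\<omega> = 1"
    hence "sin (2 * pi / 7) = 0" by (simp add: \<omega>_def cis.ctr complex_eq_iff)
    moreover have "sin (2 * pi / 7) > 0" by (rule sin_gt_zero) auto
    ultimately show False by simp
  qed
  have norm_\<omega>: "norm (\<omega> ^ j) = 1" for j by (simp add: \<omega>_def norm_power)
  define P where "P = (\<lambda>q. qpochs [\<epsilon> * q ^ a, \<epsilon> * q ^ (7 - a)] (q ^ 7) * qpochs [q ^ b, q ^ (21 - b)] (q ^ 21))"
  define L where "L = (\<lambda>k::int. \<Sum>j<7::nat. (\<omega> ^ j) powi k)"
  have L: "L k = (if 7 dvd k then 7 else 0)" for k
    unfolding L_def by (rule sum_seventh_roots_of_unity[OF \<omega>7 \<omega>1])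
  have "e k * L (int k - int n) = 0" for k
  proof (rule power_series_vanishing[where c = "\<lambda>k. e k * L (int k - int n)"])
    fix q :: complex assume q: "norm q < 1" "q \<noteq> 0"
    \<comment> \<open>Seven times the part of the series \<open>P q\<close> with exponents congruent to \<open>n\<close> modulo 7.\<close>
    define S where "S = (\<Sum>j<7::nat. (\<omega> ^ j) powi (- int n) * P (\<omega> ^ j * q))"
    define A where "A = qpoch (q ^ 7) (q ^ 7) * qpoch (q ^ 21) (q ^ 21)"
    have \<omega>0: "\<omega> ^ j \<noteq> 0" for j using norm_\<omega>[of j] by (metis norm_zero zero_neq_one)
    have q': "norm (\<omega> ^ j * q) < 1" "\<omega> ^ j * q \<noteq> 0" for j
      using q norm_\<omega>[of j] \<omega>0 by (simp_all add: norm_mult)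
    have "(\<lambda>k. \<Sum>j<7::nat. (\<omega> ^ j) powi (- int n) * (e k * (\<omega> ^ j * q) ^ k)) sums S"
      unfolding S_def using e q'(1) unfolding power_series_expansion_def P_def b_def
      by (intro sums_sum sums_mult) blast
    also have "(\<lambda>k. \<Sum>j<7::nat. (\<omega> ^ j) powi (- int n) * (e k * (\<omega> ^ j * q) ^ k)) =
        (\<lambda>k. e k * L (int k - int n) * q ^ k)"
      using \<omega>0 by (simp add: L_def sum_distrib_left sum_distrib_right power_mult_distrib power_int_diff
          power_int_minus field_simps)
    finally have series: "(\<lambda>k. e k * L (int k - int n) * q ^ k) sums S" .
    define h where "h = (\<lambda>(m, l). (- \<epsilon>) powi m * (- 1) powi l * q powi theta_exponent (int a) (int b) m l *
            L (theta_exponent (int a) (int b) m l - int n))"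
    have "(h has_sum (S * A)) UNIV"
    proof -
      have \<omega>q: "(\<omega> ^ j * q) ^ 7 = q ^ 7" "(\<omega> ^ j * q) ^ 21 = q ^ 21" for j
      proof -
        have "(\<omega> ^ j) ^ 7 = 1" by (metis \<omega>7 power_mult mult.commute power_one)
        moreover from this have "(\<omega> ^ j) ^ (7 * 3) = 1" unfolding power_mult by simp
        ultimately show "(\<omega> ^ j * q) ^ 7 = q ^ 7" "(\<omega> ^ j * q) ^ 21 = q ^ 21"
          by (simp_all add: power_mult_distrib)
      qed
      have "((\<lambda>(m, l). (- \<epsilon>) powi m * (- 1) powi l * (\<omega> ^ j * q) powi theta_exponent (int a) (int b) m l) has_sum
             (P (\<omega> ^ j * q) * A)) UNIV" for j
        using theta_product_has_sum[OF assms(1) q'[of j], of a b] assms(2,3)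
        unfolding P_def A_def \<omega>q by (auto simp: b_def)
      hence "((\<lambda>p. \<Sum>j<7::nat. (\<omega> ^ j) powi (- int n) * (case p of (m, l) \<Rightarrow> (- \<epsilon>) powi m * (- 1) powi l * (\<omega> ^ j * q) powi theta_exponent (int a) (int b) m l)) has_sum
             (\<Sum>j<7::nat. (\<omega> ^ j) powi (- int n) * (P (\<omega> ^ j * q) * A))) UNIV"
        by (intro has_sum_finite_sum has_sum_cmult_right)
      also have "(\<Sum>j<7::nat. (\<omega> ^ j) powi (- int n) * (P (\<omega> ^ j * q) * A)) = S * A"
        by (simp add: S_def sum_distrib_right mult.assoc)
      also have "(\<lambda>p. \<Sum>j<7::nat. (\<omega> ^ j) powi (- int n) * (case p of (m, l) \<Rightarrow> (- \<epsilon>) powi m * (- 1) powi l * (\<omega> ^ j * q) powi theta_exponent (int a) (int b) m l)) = h"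
        using \<omega>0 by (auto simp: h_def L_def fun_eq_iff sum_distrib_left power_int_mult_distrib power_int_diff
          power_int_minus field_simps)
      finally show ?thesis .
    qed
    hence "S * A = 0"
    proof (rule has_sum_sign_reversing_involution)
      define c where "c = 1 - 2 * int t"
      define C where "C = {(m, l). 7 dvd 4 * m + l + c}"
      define \<sigma> where "\<sigma> = (\<lambda>(m, l). ((12 * l - m - 2 * c) div 7, (4 * m + l + c) div 7))"
      have res: "7 dvd theta_exponent (int a) (int b) m l - int n \<longleftrightarrow> (m, l) \<in> C" for m l
        using theta_exponent_residue[of "int a" "int n" "int t" m l] assms(2) n by (auto simp: C_def c_def b_def mod_eq_dvd_iff)
      show "h p = 0" if "p \<notin> C" for p
        using that res by (cases p) (auto simp: h_def L)
      fix p assume p: "p \<in> C"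
      obtain m l where [simp]: "p = (m, l)" by (cases p)
      obtain l' where l': "4 * m + l + c = 7 * l'" using p by (auto simp: C_def)
      \<comment> \<open>Eliminating \<open>l = 7 * l' - 4 * m - c\<close> shows that the first component is integral as well.\<close>
      define m' where "m' = 12 * l' - 7 * m - 2 * c"
      have m': "12 * l - m - 2 * c = 7 * m'" using l' by (simp add: m'_def algebra_simps)
      have \<sigma>: "\<sigma> p = (m', l')" by (simp add: \<sigma>_def l' m')
      have inverse_eqs: "4 * m' + l' + c = 7 * l" "12 * l' - m' - 2 * c = 7 * m" using l' m' by simp_all
      show "\<sigma> p \<in> C" unfolding \<sigma> C_def using inverse_eqs by simp
      show "\<sigma> (\<sigma> p) = p" unfolding \<sigma> unfolding \<sigma>_def using inverse_eqs by simp
      have eqs: "7 * m' = 12 * l - m - 2 * (1 - 2 * int t)" "7 * l' = 4 * m + l + (1 - 2 * int t)"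
        using l' m' by (simp_all add: c_def)
      have "theta_exponent (int a) (int b) m' l' = theta_exponent (int a) (int b) m l"
        "even m' \<longleftrightarrow> even m" "even l' \<longleftrightarrow> odd l"
        using theta_exponent_reflection(1)[OF eqs, of "int a"] theta_exponent_reflection(2,3)[OF eqs]
        by (simp_all add: b_def)
      thus "h (\<sigma> p) = - h p"
        unfolding \<sigma> using assms(1) by (auto simp: h_def power_int_minus_left)
    qed
    moreover have "A \<noteq> 0"
    proof -
      have "norm (q ^ k) < 1" if "k > 0" for k
        using q(1) that by (simp add: norm_power power_less_one_iff)
      from this[of 7] this[of 21] show ?thesis by (simp add: A_def qpoch_nonzero)
    qed
    ultimately show "(\<lambda>k. e k * L (int k - int n) * q ^ k) sums 0" using series by simp
  qed
  from this[of n] show ?thesis by (simp add: L)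
qed

lemma qpochs_swap: "qpochs [x, y] q = qpochs [y, x] q"
  by (simp add: qpochs_def mult.commute)

text \<open>
  Each of the nine cases is one pair \<open>(a, t)\<close> with \<open>a \<in> {1, 2, 3}\<close> and \<open>t \<in> {0, 1, 2}\<close>. Where the given
  index is congruent to \<open>- 2 * a\<close> rather than \<open>2 * a\<close> modulo 7, it is first replaced by its
  complement to 21, which only swaps two factors of the product.
\<close>
theorem theorem3p3:
  fixes \<epsilon> :: complex and e f g :: "nat \<Rightarrow> nat \<Rightarrow> complex"
  assumes "\<epsilon> \<in> {1, -1}"
    and "\<And>\<alpha>. \<alpha> \<le> 15 \<Longrightarrow> power_series_expansion (e \<alpha>)
           (\<lambda>q. qpochs [\<epsilon> * q, \<epsilon> * q ^ 6] (q ^ 7) * qpochs [q ^ \<alpha>, q ^ (21 - \<alpha>)] (q ^ 21))"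
    and "\<And>\<beta>. \<beta> \<le> 15 \<Longrightarrow> power_series_expansion (f \<beta>)
           (\<lambda>q. qpochs [\<epsilon> * q ^ 2, \<epsilon> * q ^ 5] (q ^ 7) * qpochs [q ^ \<beta>, q ^ (21 - \<beta>)] (q ^ 21))"
    and "\<And>\<gamma>. \<gamma> \<le> 15 \<Longrightarrow> power_series_expansion (g \<gamma>)
           (\<lambda>q. qpochs [\<epsilon> * q ^ 3, \<epsilon> * q ^ 4] (q ^ 7) * qpochs [q ^ \<gamma>, q ^ (21 - \<gamma>)] (q ^ 21))"
  shows "\<forall>n. e 2 (7 * n + 5) = 0 \<and> e 5 (7 * n + 6) = 0 \<and> e 9 (7 * n + 2) = 0 \<and>
             f 3 (7 * n + 5) = 0 \<and> f 4 (7 * n + 3) = 0 \<and> f 10 (7 * n + 4) = 0 \<and>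
             g 1 (7 * n + 4) = 0 \<and> g 6 (7 * n + 1) = 0 \<and> g 8 (7 * n + 6) = 0"
proof (intro allI conjI)
  fix n :: nat
  note vanish = vanishing_coefficients[OF assms(1)]
  show "e 2 (7 * n + 5) = 0"
    by (rule vanish[of 1 0]) (use assms(2)[of 2] in simp_all)
  show "e 9 (7 * n + 2) = 0"
    by (rule vanish[of 1 1]) (use assms(2)[of 9] in simp_all)
  show "e 5 (7 * n + 6) = 0"
    by (rule vanish[of 1 2]) (use assms(2)[of 5] in \<open>simp_all add: qpochs_swap[of _ "q ^ 5" for q]\<close>)
  show "f 4 (7 * n + 3) = 0"
    by (rule vanish[of 2 0]) (use assms(3)[of 4] in simp_all)
  show "f 10 (7 * n + 4) = 0"
    by (rule vanish[of 2 1]) (use assms(3)[of 10] in \<open>simp_all add: qpochs_swap[of _ "q ^ 10" for q]\<close>)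
  show "f 3 (7 * n + 5) = 0"
    by (rule vanish[of 2 2]) (use assms(3)[of 3] in \<open>simp_all add: qpochs_swap[of _ "q ^ 3" for q]\<close>)
  show "g 6 (7 * n + 1) = 0"
    by (rule vanish[of 3 0]) (use assms(4)[of 6] in simp_all)
  show "g 8 (7 * n + 6) = 0"
    by (rule vanish[of 3 1]) (use assms(4)[of 8] in \<open>simp_all add: qpochs_swap[of _ "q ^ 8" for q]\<close>)
  show "g 1 (7 * n + 4) = 0"
    by (rule vanish[of 3 2]) (use assms(4)[of 1] in \<open>simp_all add: qpochs_swap[of _ q for q]\<close>)
qed

end
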